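(* Let $\mathcal{V}$ be a strongly irregular variety of a plural type (possibly containing constant symbols), and let $\mathcal{V}_1,\mathcal{V}_2$ be subvarieties of $R(\mathcal{V})$. Then $(\mathcal{V}_1,\mathcal{V}_2)$ is a splitting pair in $\mathbf{L}(R(\mathcal{V}))$ if and only if $(\mathcal{V}_1,\mathcal{V}_2)=(\mathcal{SL},\mathcal{V})$ or there exists $\mathcal{W}\in\mathbf{L}(\mathcal{V})$ such that $\mathcal{V}_2=R(\mathcal{W})$ and $(\mathcal{V}_1,\mathcal{W})$ is a splitting pair in $\mathbf{L}(\mathcal{V})$.
   Context: A type is plural if it contains at least one operation symbol of arity at least $2$. An identity is regular if the same variables occur on both sides. A variety $\mathcal{V}$ is strongly irregular if there is a binary term $f(x,y)$, in which both $x$ and $y$ actually occur, such that $\mathcal{V}\models f(x,y)\approx x$. The regularization $R(\mathcal{V})$ is the variety (of the same type) defined by all regular identities holding in $\mathcal{V}$. $\mathcal{SL}$ denotes $R(\mathcal{T})$, the regularization of the trivial variety $\mathcal{T}$ of the given type, i.e. the variety defined by all regular identities of that type (it is term-equivalent to the variety of semilattices, with zero if the type has constants). $\mathbf{L}(\mathcal{V})$ denotes the lattice of subvarieties of $\mathcal{V}$ ordered by inclusion. A pair $(a,b)$ of elements of a lattice $\mathbf{L}$ is a splitting pair if $a\nleq b$ and for every $c\in L$, $a\le c$ or $c\le b$. *)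

theory Defs
  imports "HOL-Algebra.Complete_Lattice"
begin

text \<open>
  The similarity type is an arity function \<open>ar\<close> on a HOL type \<open>'f\<close> of operation symbols;
  constants are the symbols of arity 0.  Raw terms carry no arity information, so identities are
  always taken between terms satisfying \<open>wf_trm ar\<close>.
\<close>

datatype (syms_trm: 'f, vars_trm: 'v) trm = Var 'v | Fun 'f "('f, 'v) trm list"

fun wf_trm :: "('f \<Rightarrow> nat) \<Rightarrow> ('f, 'v) trm \<Rightarrow> bool" where
  "wf_trm ar (Var x) \<longleftrightarrow> True"
| "wf_trm ar (Fun f ts) \<longleftrightarrow> length ts = ar f \<and> (\<forall>t \<in> set ts. wf_trm ar t)"

definition plural :: "('f \<Rightarrow> nat) \<Rightarrow> bool" where
  "plural ar \<longleftrightarrow> (\<exists>f. ar f \<ge> 2)"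

type_synonym 'f identity = "('f, nat) trm \<times> ('f, nat) trm"

definition identities :: "('f \<Rightarrow> nat) \<Rightarrow> 'f identity set" where
  "identities ar = {(s, t). wf_trm ar s \<and> wf_trm ar t}"

definition regular :: "'f identity \<Rightarrow> bool" where
  "regular e \<longleftrightarrow> vars_trm (fst e) = vars_trm (snd e)"


record ('f, 'u) algebra = "'u partial_object" +
  interp :: "'f \<Rightarrow> 'u list \<Rightarrow> 'u"

definition is_algebra :: "('f \<Rightarrow> nat) \<Rightarrow> ('f, 'u) algebra \<Rightarrow> bool" where
  "is_algebra ar A \<longleftrightarrow> carrier A \<noteq> {} \<and>
     (\<forall>f xs. length xs = ar f \<longrightarrow> set xs \<subseteq> carrier A \<longrightarrow> interp A f xs \<in> carrier A)"

fun eval_trm :: "('f, 'u) algebra \<Rightarrow> ('v \<Rightarrow> 'u) \<Rightarrow> ('f, 'v) trm \<Rightarrow> 'u" where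
  "eval_trm A \<rho> (Var x) = \<rho> x"
| "eval_trm A \<rho> (Fun f ts) = interp A f (map (eval_trm A \<rho>) ts)"

definition satisfies :: "('f, 'u) algebra \<Rightarrow> 'f identity \<Rightarrow> bool" where
  "satisfies A e \<longleftrightarrow>
     (\<forall>\<rho>. range \<rho> \<subseteq> carrier A \<longrightarrow> eval_trm A \<rho> (fst e) = eval_trm A \<rho> (snd e))"


text \<open>
  HOL has no quantification over types, so a variety is represented by the class of its members
  whose carrier is a subset of one type \<open>'u\<close>.  The members contained in \<open>'u\<close> determine the
  variety as soon as \<open>'u\<close> is large enough to contain a copy of every countably generated algebra
  of the given type; an injection of the terms over countably many variables into \<open>'u\<close>
  suffices.  See \<open>refuted_in_large_universe\<close> below.
\<close>

definition models :: "('f \<Rightarrow> nat) \<Rightarrow> 'f identity set \<Rightarrow> ('f, 'u) algebra set" where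
  "models ar \<Sigma> = {A. is_algebra ar A \<and> (\<forall>e \<in> \<Sigma>. satisfies A e)}"

definition variety :: "('f \<Rightarrow> nat) \<Rightarrow> ('f, 'u) algebra set \<Rightarrow> bool" where
  "variety ar V \<longleftrightarrow> (\<exists>\<Sigma> \<subseteq> identities ar. V = models ar \<Sigma>)"

definition holds_in :: "('f, 'u) algebra set \<Rightarrow> 'f identity \<Rightarrow> bool" where
  "holds_in V e \<longleftrightarrow> (\<forall>A \<in> V. satisfies A e)"

definition strongly_irregular :: "('f \<Rightarrow> nat) \<Rightarrow> ('f, 'u) algebra set \<Rightarrow> bool" where
  "strongly_irregular ar V \<longleftrightarrow>
     (\<exists>t x y. x \<noteq> y \<and> wf_trm ar t \<and> vars_trm t = {x, y} \<and> holds_in V (t, Var x))"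

definition regularization :: "('f \<Rightarrow> nat) \<Rightarrow> ('f, 'u) algebra set \<Rightarrow> ('f, 'u) algebra set" where
  "regularization ar V = models ar {e \<in> identities ar. regular e \<and> holds_in V e}"

definition trivial_variety :: "('f \<Rightarrow> nat) \<Rightarrow> ('f, 'u) algebra set" where
  "trivial_variety ar = {A. is_algebra ar A \<and> (\<exists>a. carrier A = {a})}"

definition SL :: "('f \<Rightarrow> nat) \<Rightarrow> ('f, 'u) algebra set" where
  "SL ar = regularization ar (trivial_variety ar)"


definition subvariety_lattice ::
    "('f \<Rightarrow> nat) \<Rightarrow> ('f, 'u) algebra set \<Rightarrow> ('f, 'u) algebra set gorder" where
  "subvariety_lattice ar V =
     \<lparr> carrier = {W. variety ar W \<and> W \<subseteq> V}, eq = (=), le = (\<subseteq>) \<rparr>"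

definition splitting_pair :: "('a, 'b) gorder_scheme \<Rightarrow> 'a \<Rightarrow> 'a \<Rightarrow> bool" where
  "splitting_pair L a b \<longleftrightarrow> a \<in> carrier L \<and> b \<in> carrier L \<and> \<not> a \<sqsubseteq>\<^bsub>L\<^esub> b \<and>
     (\<forall>c \<in> carrier L. a \<sqsubseteq>\<^bsub>L\<^esub> c \<or> c \<sqsubseteq>\<^bsub>L\<^esub> b)"


lemma variety_regularization: "variety ar (regularization ar V)"
  unfolding variety_def regularization_def by (rule exI, rule conjI[OF _ refl]) auto

lemma variety_Inter:
  assumes "\<V> \<noteq> {}" "\<And>W. W \<in> \<V> \<Longrightarrow> variety ar W"
  shows "variety ar (\<Inter>\<V>)"
proof -
  have "\<forall>W \<in> \<V>. \<exists>\<Sigma>. \<Sigma> \<subseteq> identities ar \<and> W = models ar \<Sigma>"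
    using assms(2) unfolding variety_def by blast
  then obtain S where S: "\<And>W. W \<in> \<V> \<Longrightarrow> S W \<subseteq> identities ar"
      "\<And>W. W \<in> \<V> \<Longrightarrow> W = models ar (S W)"
    by metis
  have "\<Inter>\<V> = (\<Inter>W \<in> \<V>. models ar (S W))"
    using INF_cong[of \<V> \<V> "\<lambda>W. W" "\<lambda>W. models ar (S W)"] S(2) by simp
  also have "\<dots> = models ar (\<Union>W \<in> \<V>. S W)"
    using assms(1) unfolding models_def by auto
  finally show ?thesis
    unfolding variety_def using S(1) by (intro exI[of _ "\<Union>W \<in> \<V>. S W"]) auto
qed

lemma complete_lattice_subvariety_lattice:
  assumes "variety ar V"
  shows "complete_lattice (subvariety_lattice ar V)"
proof -
  interpret partial_order "subvariety_lattice ar V"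
    by standard (auto simp: subvariety_lattice_def)
  show ?thesis
  proof (rule complete_lattice_criterion1)
    show "\<exists>g. greatest (subvariety_lattice ar V) g (carrier (subvariety_lattice ar V))"
      using assms by (intro exI[of _ V]) (auto simp: greatest_def subvariety_lattice_def)
    fix \<V> assume \<V>: "\<V> \<subseteq> carrier (subvariety_lattice ar V)" "\<V> \<noteq> {}"
    then have sub: "\<And>W. W \<in> \<V> \<Longrightarrow> variety ar W \<and> W \<subseteq> V"
      by (auto simp: subvariety_lattice_def)
    have "variety ar (\<Inter>\<V>)"
      using \<V>(2) sub by (intro variety_Inter) auto
    moreover have "\<Inter>\<V> \<subseteq> V"
      using \<V>(2) sub by blast
    moreover have "Lower (subvariety_lattice ar V) \<V> = {W. variety ar W \<and> W \<subseteq> V \<and> W \<subseteq> \<Inter>\<V>}"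
    proof -
      have "\<V> \<inter> {W. variety ar W \<and> W \<subseteq> V} = \<V>"
        using sub by blast
      then show ?thesis
        by (auto simp: Lower_def subvariety_lattice_def le_Inf_iff)
    qed
    ultimately have "greatest (subvariety_lattice ar V) (\<Inter>\<V>) (Lower (subvariety_lattice ar V) \<V>)"
      by (auto simp: greatest_def subvariety_lattice_def)
    then show "\<exists>i. greatest (subvariety_lattice ar V) i (Lower (subvariety_lattice ar V) \<V>)" ..
  qed
qed

lemma eval_trm_closed:
  assumes "is_algebra ar A" "range \<rho> \<subseteq> carrier A" "wf_trm ar t"
  shows "eval_trm A \<rho> t \<in> carrier A"
  using assms(3)
proof (induction t)
  case (Var x)
  then show ?case using assms(2) by auto
next
  case (Fun f ts)
  then have "length (map (eval_trm A \<rho>) ts) = ar f" "set (map (eval_trm A \<rho>) ts) \<subseteq> carrier A"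
    by auto
  with assms(1) show ?case
    unfolding is_algebra_def by simp
qed

lemma refuted_in_large_universe:
  fixes A :: "('f, 'w) algebra" and h :: "('f, nat) trm \<Rightarrow> 'u"
  assumes h: "inj h"
    and A: "A \<in> models ar \<Sigma>" and \<Sigma>: "\<Sigma> \<subseteq> identities ar"
    and e: "e \<in> identities ar" "\<not> satisfies A e"
  shows "\<exists>B :: ('f, 'u) algebra. B \<in> models ar \<Sigma> \<and> \<not> satisfies B e"
proof -
  have algA: "is_algebra ar A" and modA: "\<And>e. e \<in> \<Sigma> \<Longrightarrow> satisfies A e"
    using A by (auto simp: models_def)
  obtain \<rho> where \<rho>: "range \<rho> \<subseteq> carrier A" "eval_trm A \<rho> (fst e) \<noteq> eval_trm A \<rho> (snd e)"
    using e(2) by (auto simp: satisfies_def)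
  define C where "C = eval_trm A \<rho> ` {t. wf_trm ar t}"
  define \<phi> where "\<phi> = h \<circ> inv_into {t. wf_trm ar t} (eval_trm A \<rho>)"
  define \<psi> where "\<psi> = inv_into C \<phi>"
  define B :: "('f, 'u) algebra" where
    "B = \<lparr> carrier = \<phi> ` C, interp = (\<lambda>f xs. \<phi> (interp A f (map \<psi> xs))) \<rparr>"
  have inj: "inj_on \<phi> C"
    unfolding \<phi>_def C_def by (intro comp_inj_on inj_on_inv_into subset_refl inj_on_subset[OF h]) simp
  have \<psi>\<phi>: "\<psi> (\<phi> c) = c" if "c \<in> C" for c
    unfolding \<psi>_def using inj that by (rule inv_into_f_f)
  have \<psi>C: "\<psi> u \<in> C" if "u \<in> carrier B" for u
    using that \<psi>\<phi> by (auto simp: B_def)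
  have \<phi>\<psi>: "\<phi> (\<psi> u) = u" if "u \<in> carrier B" for u
    using that \<psi>\<phi> by (auto simp: B_def)
  have CA: "C \<subseteq> carrier A"
    unfolding C_def using eval_trm_closed[OF algA \<rho>(1)] by auto
  have var_C: "\<rho> x \<in> C" for x
    unfolding C_def by (rule image_eqI[of _ _ "Var x"]) auto
  have closed: "interp A f cs \<in> C" if "length cs = ar f" "set cs \<subseteq> C" for f cs
  proof -
    let ?ts = "map (inv_into {t. wf_trm ar t} (eval_trm A \<rho>)) cs"
    have *: "wf_trm ar (inv_into {t. wf_trm ar t} (eval_trm A \<rho>) c)"
        "eval_trm A \<rho> (inv_into {t. wf_trm ar t} (eval_trm A \<rho>) c) = c" if "c \<in> C" for c
      using that inv_into_into[of c "eval_trm A \<rho>" "{t. wf_trm ar t}"]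
        f_inv_into_f[of c "eval_trm A \<rho>" "{t. wf_trm ar t}"]
      unfolding C_def by auto
    have "wf_trm ar (Fun f ?ts)"
      using that * by auto
    moreover have "map (eval_trm A \<rho>) ?ts = cs"
      using that *(2) by (auto intro!: map_idI)
    then have "eval_trm A \<rho> (Fun f ?ts) = interp A f cs"
      by simp
    ultimately show ?thesis
      unfolding C_def by (metis imageI mem_Collect_eq)
  qed
  have algC: "is_algebra ar \<lparr> carrier = C, interp = interp A \<rparr>"
    using closed var_C by (auto simp: is_algebra_def)
  have eval_C: "eval_trm \<lparr> carrier = C, interp = interp A \<rparr> \<tau> t = eval_trm A \<tau> t"
    for \<tau> and t :: "('f, nat) trm"
    by (induction t) (auto cong: map_cong)
  have C_closed: "eval_trm A \<tau> t \<in> C" if "range \<tau> \<subseteq> C" "wf_trm ar t"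
    for \<tau> and t :: "('f, nat) trm"
    using eval_trm_closed[OF algC, of \<tau> t] that eval_C by simp
  have algB: "is_algebra ar B"
    unfolding is_algebra_def
  proof (intro conjI allI impI)
    show "carrier B \<noteq> {}"
      using var_C by (auto simp: B_def)
    fix f xs assume "length xs = ar f" "set xs \<subseteq> carrier B"
    then have "interp A f (map \<psi> xs) \<in> C"
      using \<psi>C by (intro closed) auto
    then show "interp B f xs \<in> carrier B"
      by (simp add: B_def)
  qed
  have eval_B: "\<psi> (eval_trm B \<sigma> t) = eval_trm A (\<psi> \<circ> \<sigma>) t"
    if "range \<sigma> \<subseteq> carrier B" "wf_trm ar t" for \<sigma> and t :: "('f, nat) trm"
    using that(2)
  proof (induction t)
    case (Fun f ts)
    then have IH: "map \<psi> (map (eval_trm B \<sigma>) ts) = map (eval_trm A (\<psi> \<circ> \<sigma>)) ts"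
      by (auto simp: comp_def)
    have "range (\<psi> \<circ> \<sigma>) \<subseteq> C"
      using that(1) \<psi>C by auto
    then have "eval_trm A (\<psi> \<circ> \<sigma>) (Fun f ts) \<in> C"
      using Fun.prems by (rule C_closed)
    moreover have "eval_trm B \<sigma> (Fun f ts) = \<phi> (interp A f (map \<psi> (map (eval_trm B \<sigma>) ts)))"
      by (simp add: B_def)
    ultimately show ?case
      unfolding IH by (simp only: eval_trm.simps \<psi>\<phi>)
  qed auto
  have "satisfies B e'" if "e' \<in> \<Sigma>" for e'
    unfolding satisfies_def
  proof (intro allI impI)
    fix \<sigma> :: "nat \<Rightarrow> 'u" assume \<sigma>: "range \<sigma> \<subseteq> carrier B"
    have wf: "wf_trm ar (fst e')" "wf_trm ar (snd e')"
      using that \<Sigma> by (auto simp: identities_def)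
    have "range (\<psi> \<circ> \<sigma>) \<subseteq> carrier A"
      using \<sigma> \<psi>C CA by auto
    with modA[OF that] have "eval_trm A (\<psi> \<circ> \<sigma>) (fst e') = eval_trm A (\<psi> \<circ> \<sigma>) (snd e')"
      by (simp add: satisfies_def)
    then have "\<psi> (eval_trm B \<sigma> (fst e')) = \<psi> (eval_trm B \<sigma> (snd e'))"
      using eval_B[OF \<sigma>] wf by simp
    then show "eval_trm B \<sigma> (fst e') = eval_trm B \<sigma> (snd e')"
      using \<phi>\<psi> eval_trm_closed[OF algB \<sigma>] wf by metis
  qed
  then have "B \<in> models ar \<Sigma>"
    using algB by (simp add: models_def)
  moreover have "\<not> satisfies B e"
  proof
    assume sat: "satisfies B e"
    have \<sigma>: "range (\<phi> \<circ> \<rho>) \<subseteq> carrier B"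
      using var_C by (auto simp: B_def)
    have "\<psi> \<circ> (\<phi> \<circ> \<rho>) = \<rho>"
      using \<psi>\<phi> var_C by auto
    then have "eval_trm A \<rho> (fst e) = eval_trm A \<rho> (snd e)"
      using sat \<sigma> eval_B[OF \<sigma>] e(1) unfolding satisfies_def identities_def
      by (metis (mono_tags, lifting) case_prodE fst_conv mem_Collect_eq snd_conv)
    with \<rho>(2) show False ..
  qed
  ultimately show ?thesis by blast
qed

end

theory Submission
  imports Defs
begin

text \<open>
  Let \<open>x \<cdot> y\<close> be the binary term with \<open>V \<Turnstile> x \<cdot> y \<approx> x\<close>.
  A member of \<open>R(V)\<close> satisfying some irregular identity also satisfies \<open>x \<cdot> y \<approx> x\<close>
  and hence lies in \<open>V\<close>.  For an arbitrary \<open>A \<in> R(V)\<close> and \<open>u \<in> A\<close>, the elements \<open>a\<close>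
  with \<open>a \<cdot> u = a\<close> and \<open>u \<cdot> a = u\<close> form an algebra under the operations
  \<open>f(a\<^sub>1, \<dots>, a\<^sub>n) \<cdot> u\<close>; multiplying by \<open>u\<close> is what makes constants cause no trouble.  This
  fibre lies in \<open>V\<close>, inherits all identities of \<open>A\<close>, and a regular identity \<open>s \<approx> t\<close> can be
  tested in \<open>A\<close> by testing it in the fibre of the value of \<open>s\<close>.  Consequently a
  subvariety \<open>W\<close> of \<open>R(V)\<close> is either contained in \<open>V\<close>, or contains \<open>SL\<close> and equals
  \<open>R(W \<inter> V)\<close>; the splitting pairs are then read off from this description of the lattice.
\<close>

section \<open>Substitution\<close>

fun subst_trm :: "('v \<Rightarrow> ('f, 'w) trm) \<Rightarrow> ('f, 'v) trm \<Rightarrow> ('f, 'w) trm" where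
  "subst_trm \<sigma> (Var x) = \<sigma> x"
| "subst_trm \<sigma> (Fun f ts) = Fun f (map (subst_trm \<sigma>) ts)"

lemma eval_subst_trm:
  "eval_trm A \<rho> (subst_trm \<sigma> t) = eval_trm A (\<lambda>v. eval_trm A \<rho> (\<sigma> v)) t"
  by (induction t) (auto simp: comp_def cong: map_cong)

lemma vars_subst_trm: "vars_trm (subst_trm \<sigma> t) = (\<Union>v \<in> vars_trm t. vars_trm (\<sigma> v))"
  by (induction t) auto

lemma wf_subst_trm:
  "wf_trm ar t \<Longrightarrow> (\<And>v. v \<in> vars_trm t \<Longrightarrow> wf_trm ar (\<sigma> v)) \<Longrightarrow> wf_trm ar (subst_trm \<sigma> t)"
  by (induction t) auto

lemma eval_trm_cong:
  "(\<And>v. v \<in> vars_trm t \<Longrightarrow> \<rho> v = \<rho>' v) \<Longrightarrow> eval_trm A \<rho> t = eval_trm A \<rho>' t"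
proof (induction t)
  case (Fun f ts)
  then have "map (eval_trm A \<rho>) ts = map (eval_trm A \<rho>') ts"
    by auto
  then show ?case by (simp only: eval_trm.simps)
qed simp

section \<open>Varieties and regularization\<close>

lemma satisfiesD:
  "satisfies A (s, t) \<Longrightarrow> range \<rho> \<subseteq> carrier A \<Longrightarrow> eval_trm A \<rho> s = eval_trm A \<rho> t"
  by (simp add: satisfies_def)

lemma variety_is_algebra: "variety ar V \<Longrightarrow> A \<in> V \<Longrightarrow> is_algebra ar A"
  by (auto simp: variety_def models_def)

lemma mem_varietyI:
  assumes "variety ar V" "is_algebra ar A"
    and "\<And>e. e \<in> identities ar \<Longrightarrow> holds_in V e \<Longrightarrow> satisfies A e"
  shows "A \<in> V"
  using assms unfolding variety_def models_def holds_in_def by blast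

lemma variety_Int: "variety ar V \<Longrightarrow> variety ar W \<Longrightarrow> variety ar (V \<inter> W)"
  using variety_Inter[of "{V, W}" ar] by auto

lemma regularization_is_algebra: "A \<in> regularization ar V \<Longrightarrow> is_algebra ar A"
  by (simp add: regularization_def models_def)

lemma regularization_mono: "V \<subseteq> W \<Longrightarrow> regularization ar V \<subseteq> regularization ar W"
  unfolding regularization_def models_def holds_in_def by blast

lemma subset_regularization: "variety ar V \<Longrightarrow> V \<subseteq> regularization ar V"
  unfolding regularization_def models_def holds_in_def using variety_is_algebra by blast

text \<open>The tool for every computation in a member of R(V): an equation between terms with the
  same variables needs checking only in \<open>V\<close>, where products will collapse to their left
  factor.\<close>

lemma regularization_eval_eq:
  fixes s t :: "('f, nat) trm"
  assumes "A \<in> regularization ar V" "wf_trm ar s" "wf_trm ar t" "vars_trm s = vars_trm t"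
    and "range \<rho> \<subseteq> carrier A"
    and "\<And>B \<tau>. B \<in> V \<Longrightarrow> range \<tau> \<subseteq> carrier B \<Longrightarrow> eval_trm B \<tau> s = eval_trm B \<tau> t"
  shows "eval_trm A \<rho> s = eval_trm A \<rho> t"
proof -
  have "(s, t) \<in> {e \<in> identities ar. regular e \<and> holds_in V e}"
    using assms by (auto simp: identities_def regular_def holds_in_def satisfies_def)
  then have "satisfies A (s, t)"
    using assms(1) unfolding regularization_def models_def by blast
  then show ?thesis
    using assms(5) by (rule satisfiesD)
qed

section \<open>The trivial variety and semilattices\<close>

lemma trivial_variety_eq_models:
  fixes ar :: "'f \<Rightarrow> nat"
  shows "(trivial_variety ar :: ('f, 'u) algebra set) = models ar {(Var 0, Var 1)}"
proof (intro equalityI subsetI)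
  fix A :: "('f, 'u) algebra" assume "A \<in> trivial_variety ar"
  then show "A \<in> models ar {(Var 0, Var 1)}"
    by (auto simp: trivial_variety_def models_def satisfies_def image_subset_iff)
next
  fix A :: "('f, 'u) algebra" assume A: "A \<in> models ar {(Var 0, Var 1)}"
  then obtain a where a: "a \<in> carrier A"
    by (auto simp: models_def is_algebra_def)
  have "b = a" if "b \<in> carrier A" for b
  proof -
    have "satisfies A (Var 0, Var 1)"
      using A by (simp add: models_def)
    from satisfiesD[OF this, of "\<lambda>n. if n = 0 then b else a"] show ?thesis
      using a that by auto
  qed
  with a have "carrier A = {a}" by blast
  with A show "A \<in> trivial_variety ar"
    by (auto simp: trivial_variety_def models_def)
qed

lemma variety_trivial_variety: "variety ar (trivial_variety ar)"
  unfolding variety_def trivial_variety_eq_models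
  by (rule exI[of _ "{(Var 0, Var 1)}"]) (simp add: identities_def)

lemma trivial_variety_satisfies:
  assumes "A \<in> trivial_variety ar" "e \<in> identities ar"
  shows "satisfies A e"
proof -
  obtain a where A: "is_algebra ar A" "carrier A = {a}"
    using assms(1) by (auto simp: trivial_variety_def)
  have wf: "wf_trm ar (fst e)" "wf_trm ar (snd e)"
    using assms(2) by (auto simp: identities_def)
  show ?thesis
    using eval_trm_closed[OF A(1) _ wf(1)] eval_trm_closed[OF A(1) _ wf(2)]
    by (auto simp: satisfies_def A(2))
qed

lemma trivial_variety_subset: "variety ar V \<Longrightarrow> trivial_variety ar \<subseteq> V"
  by (rule subsetI, erule mem_varietyI) (auto simp: trivial_variety_def intro: trivial_variety_satisfies)

text \<open>One-element algebras satisfy every identity, so the condition \<open>holds_in\<close> is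
  vacuous in the regularization of the trivial variety.\<close>

lemma SL_eq_models: "SL ar = models ar {e \<in> identities ar. regular e}"
  unfolding SL_def regularization_def
  by (rule arg_cong[of _ _ "models ar"]) (auto simp: holds_in_def intro: trivial_variety_satisfies)

lemma SL_subset_if_regular:
  assumes "variety ar V" "\<And>e. e \<in> identities ar \<Longrightarrow> holds_in V e \<Longrightarrow> regular e"
  shows "SL ar \<subseteq> V"
  by (rule subsetI, rule mem_varietyI[OF assms(1)]) (auto simp: SL_eq_models models_def assms(2))

text \<open>Occurrence of a variable in a term is visible in a two-element semilattice, built here
  on two distinct points of \<open>'u\<close>.\<close>

lemma SL_refutes_irregular:
  fixes a b :: 'u
  assumes "a \<noteq> b" "e \<in> identities ar" "holds_in (SL ar :: ('f, 'u) algebra set) e"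
  shows "regular e"
proof -
  \<comment> \<open>The element \<open>a\<close> is absorbing; constants denote \<open>b\<close>
    because an empty argument list does not contain \<open>a\<close>.\<close>
  define S :: "('f, 'u) algebra" where
    "S = \<lparr> carrier = {a, b}, interp = (\<lambda>f xs. if a \<in> set xs then a else b) \<rparr>"
  have eval: "eval_trm S \<rho> t = (if a \<in> \<rho> ` vars_trm t then a else b)"
    if \<rho>: "range \<rho> \<subseteq> {a, b}" for \<rho> and t :: "('f, nat) trm"
  proof (induction t)
    case (Var x)
    have "\<rho> x \<in> {a, b}" using \<rho> by blast
    then show ?case by auto
  next
    case (Fun f ts)
    have "a \<in> set (map (eval_trm S \<rho>) ts) \<longleftrightarrow> (\<exists>t \<in> set ts. a \<in> \<rho> ` vars_trm t)"
      using Fun assms(1) by (auto simp: image_iff split: if_splits)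
    also have "\<dots> \<longleftrightarrow> a \<in> \<rho> ` vars_trm (Fun f ts)"
      by auto
    finally show ?case
      by (simp add: S_def)
  qed
  have "is_algebra ar S"
    by (auto simp: is_algebra_def S_def)
  moreover have "satisfies S e'" if "regular e'" for e'
    using that eval by (simp add: satisfies_def regular_def S_def)
  ultimately have "S \<in> SL ar"
    by (simp add: SL_eq_models models_def)
  then have sat: "satisfies S e"
    using assms(3) by (simp add: holds_in_def)
  have "v \<in> vars_trm (fst e) \<longleftrightarrow> v \<in> vars_trm (snd e)" for v
  proof -
    \<comment> \<open>Only \<open>v\<close> is sent to the absorbing element, so a term takes the
      value \<open>a\<close> exactly when \<open>v\<close> occurs in it.\<close>
    let ?\<rho> = "\<lambda>w. if w = v then a else b"
    have \<rho>: "range ?\<rho> \<subseteq> {a, b}" by auto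
    have "eval_trm S ?\<rho> (fst e) = eval_trm S ?\<rho> (snd e)"
      using sat \<rho> by (auto simp: satisfies_def S_def)
    moreover have "a \<in> ?\<rho> ` X \<longleftrightarrow> v \<in> X" for X
      using assms(1) by auto
    ultimately show ?thesis
      using assms(1) unfolding eval[OF \<rho>] by (auto split: if_splits)
  qed
  then show ?thesis
    by (auto simp: regular_def)
qed

section \<open>Strongly irregular varieties\<close>

locale strongly_irregular_variety =
  fixes ar :: "'f \<Rightarrow> nat" and V :: "('f, 'u) algebra set"
    and p :: "('f, nat) trm" and x y :: nat
  assumes variety: "variety ar V"
    and distinct: "x \<noteq> y"
    and wf_p: "wf_trm ar p"
    and vars_p: "vars_trm p = {x, y}"
    and holds_p: "holds_in V (p, Var x)"
begin

text \<open>The term x \<cdot> y of the overview and, in \<open>dot\<close>, its operation on an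
  algebra. The else branch serves \<open>y\<close>, the only other variable of
  \<open>p\<close>.\<close>

definition mult :: "('f, nat) trm \<Rightarrow> ('f, nat) trm \<Rightarrow> ('f, nat) trm" where
  "mult s t = subst_trm (\<lambda>z. if z = x then s else t) p"

definition dot :: "('f, 'u) algebra \<Rightarrow> 'u \<Rightarrow> 'u \<Rightarrow> 'u" where
  "dot A a b = eval_trm A (\<lambda>z. if z = x then a else b) p"

text \<open>The same witness \<open>p\<close> works below \<open>V\<close>, so the results of this
  locale become available with \<open>W\<close> in place of \<open>V\<close>;
  \<open>regularization_Int\<close> relies on this.\<close>

lemma subvariety:
  assumes "variety ar W" "W \<subseteq> V"
  shows "strongly_irregular_variety ar W p x y"
  using assms distinct wf_p vars_p holds_p by unfold_locales (auto simp: holds_in_def)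

lemma vars_mult [simp]: "vars_trm (mult s t) = vars_trm s \<union> vars_trm t"
  using distinct by (auto simp: mult_def vars_subst_trm vars_p)

lemma wf_mult [simp]: "wf_trm ar s \<Longrightarrow> wf_trm ar t \<Longrightarrow> wf_trm ar (mult s t)"
  by (auto simp: mult_def intro: wf_subst_trm wf_p)

lemma eval_mult: "eval_trm A \<rho> (mult s t) = dot A (eval_trm A \<rho> s) (eval_trm A \<rho> t)"
  by (simp add: mult_def dot_def eval_subst_trm if_distrib cong: if_cong)

lemma eval_p: "eval_trm A \<rho> p = dot A (\<rho> x) (\<rho> y)"
  unfolding dot_def using vars_p distinct by (intro eval_trm_cong) auto

lemma dot_closed:
  "is_algebra ar A \<Longrightarrow> a \<in> carrier A \<Longrightarrow> b \<in> carrier A \<Longrightarrow> dot A a b \<in> carrier A"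
  unfolding dot_def by (rule eval_trm_closed) (auto intro: wf_p)

lemma eval_mult_V:
  assumes "B \<in> V" "range \<tau> \<subseteq> carrier B" "wf_trm ar s" "wf_trm ar t"
  shows "eval_trm B \<tau> (mult s t) = eval_trm B \<tau> s"
proof -
  have alg: "is_algebra ar B"
    using variety assms(1) by (rule variety_is_algebra)
  let ?\<rho> = "\<lambda>z. if z = x then eval_trm B \<tau> s else eval_trm B \<tau> t"
  have "range ?\<rho> \<subseteq> carrier B"
    using eval_trm_closed[OF alg assms(2)] assms(3,4) by auto
  moreover have "satisfies B (p, Var x)"
    using holds_p assms(1) by (auto simp: holds_in_def)
  ultimately have "eval_trm B ?\<rho> p = eval_trm B ?\<rho> (Var x)"
    using satisfiesD by blast
  then show ?thesis
    by (simp add: eval_mult dot_def)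
qed

text \<open>Since \<open>t\<close> adds no variables, \<open>mult s t\<close> \<approx>
  \<open>s\<close> is a regular identity of \<open>V\<close>.\<close>

lemma eval_mult_left:
  fixes s t :: "('f, nat) trm"
  assumes "A \<in> regularization ar V" "range \<rho> \<subseteq> carrier A" "wf_trm ar s" "wf_trm ar t"
    and "vars_trm t \<subseteq> vars_trm s"
  shows "dot A (eval_trm A \<rho> s) (eval_trm A \<rho> t) = eval_trm A \<rho> s"
  unfolding eval_mult[symmetric]
  by (rule regularization_eval_eq[OF assms(1)]) (use assms in \<open>auto simp: eval_mult_V\<close>)

text \<open>For an identity s \<approx> t of \<open>V\<close>, the identity s \<cdot> t \<approx> t
  \<cdot> s is regular and holds in \<open>V\<close>, hence in \<open>A\<close>, where left
  projection turns it back into s \<approx> t.\<close>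

lemma mem_V_if_dot_eq:
  assumes A: "A \<in> regularization ar V"
    and dot: "\<And>a b. a \<in> carrier A \<Longrightarrow> b \<in> carrier A \<Longrightarrow> dot A a b = a"
  shows "A \<in> V"
proof (rule mem_varietyI[OF variety])
  show alg: "is_algebra ar A"
    using A by (rule regularization_is_algebra)
  fix e :: "'f identity" assume e: "e \<in> identities ar" "holds_in V e"
  obtain s t where st: "e = (s, t)" by fastforce
  have wf: "wf_trm ar s" "wf_trm ar t"
    using e(1) by (auto simp: st identities_def)
  have V: "eval_trm B \<tau> s = eval_trm B \<tau> t" if "B \<in> V" "range \<tau> \<subseteq> carrier B" for B \<tau>
    using e(2) that by (auto simp: st holds_in_def intro: satisfiesD)
  have "eval_trm A \<rho> s = eval_trm A \<rho> t" if \<rho>: "range \<rho> \<subseteq> carrier A" for \<rho>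
  proof -
    have "eval_trm A \<rho> (mult s t) = eval_trm A \<rho> (mult t s)"
      by (rule regularization_eval_eq[OF A _ _ _ \<rho>]) (use wf V in \<open>auto simp: eval_mult_V\<close>)
    then show ?thesis
      using eval_trm_closed[OF alg \<rho>] wf by (simp add: eval_mult dot)
  qed
  then show "satisfies A e"
    by (simp add: st satisfies_def)
qed

text \<open>Identifying all variables but \<open>v\<close> leaves an identity s'(x0, x1) \<approx>
  t'(x0). Left multiplication by x0 yields x0 \<cdot> x1 \<approx> x0 \<cdot> s' \<approx> x0
  \<cdot> t' \<approx> x0, where the outer steps are regular identities of \<open>V\<close>.\<close>

lemma dot_eq_if_irregular:
  assumes A: "A \<in> regularization ar V" and sat: "satisfies A (s, t)"
    and wf: "wf_trm ar s" "wf_trm ar t" and v: "v \<in> vars_trm s" "v \<notin> vars_trm t"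
    and a: "a \<in> carrier A" and b: "b \<in> carrier A"
  shows "dot A b a = b"
proof -
  define \<sigma> :: "nat \<Rightarrow> ('f, nat) trm" where "\<sigma> = (\<lambda>w. if w = v then Var 1 else Var 0)"
  define \<rho> where "\<rho> = (\<lambda>n :: nat. if n = 0 then b else a)"
  have \<rho>: "range \<rho> \<subseteq> carrier A"
    using a b by (auto simp: \<rho>_def)
  have wf': "wf_trm ar (subst_trm \<sigma> s)" "wf_trm ar (subst_trm \<sigma> t)"
    using wf by (auto intro!: wf_subst_trm simp: \<sigma>_def)
  \<comment> \<open>Variable 0 may be absent from either term, and the second may have no variables
    at all; the factor \<open>Var 0\<close> in the products below restores regularity.\<close>
  have vars: "vars_trm (subst_trm \<sigma> t) \<subseteq> {0}" "insert 0 (vars_trm (subst_trm \<sigma> s)) = {0, 1}"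
    using v by (auto simp: vars_subst_trm \<sigma>_def split: if_splits)
  have "range (\<lambda>w. eval_trm A \<rho> (\<sigma> w)) \<subseteq> carrier A"
    using a b by (auto simp: \<sigma>_def \<rho>_def)
  then have eq: "eval_trm A \<rho> (subst_trm \<sigma> s) = eval_trm A \<rho> (subst_trm \<sigma> t)"
    unfolding eval_subst_trm by (rule satisfiesD[OF sat])
  have "eval_trm A \<rho> (mult (Var 0) (subst_trm \<sigma> s)) = eval_trm A \<rho> (mult (Var 0) (Var 1))"
    by (rule regularization_eval_eq[OF A _ _ _ \<rho>])
      (use wf' vars in \<open>auto simp: eval_mult_V\<close>)
  moreover have "dot A (eval_trm A \<rho> (Var 0)) (eval_trm A \<rho> (subst_trm \<sigma> t)) = eval_trm A \<rho> (Var 0)"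
    by (rule eval_mult_left[OF A \<rho>]) (use wf' vars in auto)
  ultimately show ?thesis
    by (simp add: eval_mult eq) (simp add: \<rho>_def)
qed

lemma mem_V_if_irregular:
  assumes A: "A \<in> regularization ar V"
    and e: "e \<in> identities ar" "\<not> regular e" and sat: "satisfies A e"
  shows "A \<in> V"
proof -
  obtain s t where st: "e = (s, t)" by fastforce
  have wf: "wf_trm ar s" "wf_trm ar t"
    using e(1) by (auto simp: st identities_def)
  have sat: "satisfies A (s, t)" "satisfies A (t, s)"
    using sat by (auto simp: st satisfies_def)
  have "vars_trm s \<noteq> vars_trm t"
    using e(2) by (simp add: st regular_def)
  then consider v where "v \<in> vars_trm s" "v \<notin> vars_trm t" | v where "v \<in> vars_trm t" "v \<notin> vars_trm s"
    by blast
  then show ?thesis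
  proof cases
    case (1 v)
    show ?thesis
      by (rule mem_V_if_dot_eq[OF A]) (rule dot_eq_if_irregular[OF A sat(1) wf 1])
  next
    case (2 v)
    show ?thesis
      by (rule mem_V_if_dot_eq[OF A]) (rule dot_eq_if_irregular[OF A sat(2) wf(2,1) 2])
  qed
qed

lemma subset_V_if_irregular:
  assumes "W \<subseteq> regularization ar V" "e \<in> identities ar" "\<not> regular e" "holds_in W e"
  shows "W \<subseteq> V"
  using assms mem_V_if_irregular by (fastforce simp: holds_in_def)

lemma p_identity: "(p, Var x) \<in> identities ar" "\<not> regular (p, Var x)"
  using wf_p vars_p distinct by (auto simp: identities_def regular_def)

text \<open>Apply \<open>mem_V_if_irregular\<close> with \<open>W\<close> as base: members of
  \<open>V\<close> satisfy the irregular identity p \<approx> x, so those in R(W) fall into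
  \<open>W\<close>.\<close>

lemma regularization_Int:
  assumes W: "variety ar W" "W \<subseteq> V"
  shows "regularization ar W \<inter> V = W"
proof
  interpret W: strongly_irregular_variety ar W p x y
    using W by (rule subvariety)
  show "regularization ar W \<inter> V \<subseteq> W"
    using W.mem_V_if_irregular[OF _ p_identity] holds_p by (auto simp: holds_in_def)
  show "W \<subseteq> regularization ar W \<inter> V"
    using W subset_regularization by blast
qed

section \<open>Fibres\<close>

text \<open>For \<open>A\<close> in R(V) the carrier is the block of \<open>u\<close> under mutual
  absorption, as in a Plonka sum. A constant may denote an element of another block; the final
  factor \<open>u\<close> brings it into this one.\<close>

definition fibre :: "('f, 'u) algebra \<Rightarrow> 'u \<Rightarrow> ('f, 'u) algebra" where
  "fibre A u = \<lparr> carrier = {a \<in> carrier A. dot A a u = a \<and> dot A u a = u},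
     interp = (\<lambda>f as. dot A (interp A f as) u) \<rparr>"

lemma carrier_fibre: "carrier (fibre A u) = {a \<in> carrier A. dot A a u = a \<and> dot A u a = u}"
  by (simp add: fibre_def)

lemma interp_fibre: "interp (fibre A u) f as = dot A (interp A f as) u"
  by (simp add: fibre_def)

lemma dot_dot_right:
  assumes "A \<in> regularization ar V" "a \<in> carrier A" "u \<in> carrier A"
  shows "dot A (dot A a u) u = dot A a u"
  using eval_mult_left[OF assms(1), of "\<lambda>n. if n = 0 then a else u" "mult (Var 0) (Var 1)" "Var 1"]
    assms by (auto simp: eval_mult)

lemma dot_idem:
  assumes "A \<in> regularization ar V" "u \<in> carrier A"
  shows "dot A u u = u"
  using eval_mult_left[OF assms(1), of "\<lambda>n. u" "Var 0" "Var 0"] assms by auto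

text \<open>For \<open>b\<close> in the fibre of \<open>u\<close> the product
  \<open>dot A u b\<close> is \<open>u\<close>, so \<open>b\<close> disappears; this gives left
  projection in \<open>fibre_mem_V\<close>.\<close>

lemma dot_dot_absorb:
  assumes A: "A \<in> regularization ar V" and "a \<in> carrier A" "b \<in> carrier A" "u \<in> carrier A"
  shows "dot A (dot A a b) u = dot A (dot A a (dot A u b)) u"
proof -
  define \<rho> where "\<rho> = (\<lambda>n :: nat. if n = 0 then a else if n = 1 then b else u)"
  have \<rho>: "range \<rho> \<subseteq> carrier A"
    using assms by (auto simp: \<rho>_def)
  have "eval_trm A \<rho> (mult (mult (Var 0) (Var 1)) (Var 2)) =
      eval_trm A \<rho> (mult (mult (Var 0) (mult (Var 2) (Var 1))) (Var 2))"
    by (rule regularization_eval_eq[OF A _ _ _ \<rho>]) (auto simp: eval_mult_V)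
  then show ?thesis
    by (simp add: eval_mult \<rho>_def)
qed

text \<open>The left-nested product \<open>foldl mult s ts\<close> equals \<open>s\<close> in
  \<open>V\<close> while carrying all variables of \<open>ts\<close>; it stands in for
  \<open>u\<close> in \<open>dot_interp\<close>, where a regular identity is needed.\<close>

lemma vars_foldl_mult:
  "vars_trm (foldl mult s ts) = vars_trm s \<union> (\<Union>t \<in> set ts. vars_trm t)"
  by (induction ts arbitrary: s) auto

lemma wf_foldl_mult:
  "wf_trm ar s \<Longrightarrow> (\<And>t. t \<in> set ts \<Longrightarrow> wf_trm ar t) \<Longrightarrow> wf_trm ar (foldl mult s ts)"
  by (induction ts arbitrary: s) auto

lemma eval_foldl_mult:
  "eval_trm A \<rho> (foldl mult s ts) = foldl (dot A) (eval_trm A \<rho> s) (map (eval_trm A \<rho>) ts)"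
  by (induction ts arbitrary: s) (auto simp: eval_mult)

lemma eval_foldl_mult_V:
  assumes "B \<in> V" "range \<tau> \<subseteq> carrier B" "wf_trm ar s" "\<And>t. t \<in> set ts \<Longrightarrow> wf_trm ar t"
  shows "eval_trm B \<tau> (foldl mult s ts) = eval_trm B \<tau> s"
  using assms(3,4) by (induction ts arbitrary: s) (auto simp: eval_mult_V assms(1,2))

text \<open>In \<open>V\<close> the first equation loses all factors \<open>u\<close>, and both
  sides of the second collapse to \<open>u\<close>; the products make both identities
  regular.\<close>

lemma
  assumes A: "A \<in> regularization ar V" and u: "u \<in> carrier A"
    and as: "length as = ar f" "set as \<subseteq> carrier A"
  shows interp_dot: "dot A (interp A f (map (\<lambda>a. dot A a u) as)) u = dot A (interp A f as) u"
    and dot_interp: "dot A u (dot A (interp A f as) u) = foldl (dot A) u as"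
proof -
  define n where "n = ar f"
  \<comment> \<open>Variables below \<open>n\<close> stand for the arguments, \<open>n\<close> and
    all later ones for \<open>u\<close>.\<close>
  define \<rho> where "\<rho> = (\<lambda>i. if i < n then as ! i else u)"
  have \<rho>: "range \<rho> \<subseteq> carrier A"
    using u as by (auto simp: \<rho>_def n_def)
  have as_eq: "map \<rho> [0..<n] = as"
    using as by (intro nth_equalityI) (auto simp: \<rho>_def n_def)
  let ?u = "Var n :: ('f, nat) trm" and ?xs = "map Var [0..<n] :: ('f, nat) trm list"
  have eval_u: "eval_trm A \<rho> ?u = u"
    by (simp add: \<rho>_def)
  have eval_xs: "map (eval_trm A \<rho>) ?xs = as"
    using as_eq by (simp add: comp_def)
  have map_V: "map (eval_trm B \<tau>) (map (\<lambda>i. mult (Var i) ?u) [0..<n]) = map (eval_trm B \<tau>) ?xs"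
    if "B \<in> V" "range \<tau> \<subseteq> carrier B" for B and \<tau> :: "nat \<Rightarrow> 'u"
    using that by (simp add: eval_mult_V)
  have "eval_trm A \<rho> (mult (Fun f (map (\<lambda>i. mult (Var i) ?u) [0..<n])) ?u) =
      eval_trm A \<rho> (mult (Fun f ?xs) ?u)"
  proof (rule regularization_eval_eq[OF A _ _ _ \<rho>])
    fix B and \<tau> :: "nat \<Rightarrow> 'u" assume B: "B \<in> V" "range \<tau> \<subseteq> carrier B"
    show "eval_trm B \<tau> (mult (Fun f (map (\<lambda>i. mult (Var i) ?u) [0..<n])) ?u) =
        eval_trm B \<tau> (mult (Fun f ?xs) ?u)"
      by (subst (1 2) eval_mult_V[OF B])
        (use map_V[OF B] in \<open>auto simp: n_def simp del: map_map\<close>)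
  qed (auto simp: n_def)
  moreover have "map (eval_trm A \<rho>) (map (\<lambda>i. mult (Var i) ?u) [0..<n]) =
      map (\<lambda>a. dot A a u) (map (eval_trm A \<rho>) ?xs)"
    using eval_u by (simp add: eval_mult comp_def)
  ultimately show "dot A (interp A f (map (\<lambda>a. dot A a u) as)) u = dot A (interp A f as) u"
    by (simp only: eval_mult eval_u eval_trm.simps(2) eval_xs)
  have "eval_trm A \<rho> (mult ?u (mult (Fun f ?xs) ?u)) = eval_trm A \<rho> (foldl mult ?u ?xs)"
  proof (rule regularization_eval_eq[OF A _ _ _ \<rho>])
    fix B and \<tau> :: "nat \<Rightarrow> 'u" assume B: "B \<in> V" "range \<tau> \<subseteq> carrier B"
    show "eval_trm B \<tau> (mult ?u (mult (Fun f ?xs) ?u)) = eval_trm B \<tau> (foldl mult ?u ?xs)"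
      by (subst eval_mult_V[OF B], simp, simp add: n_def, subst eval_foldl_mult_V[OF B]) auto
  qed (auto simp: n_def vars_foldl_mult intro!: wf_foldl_mult)
  then show "dot A u (dot A (interp A f as) u) = foldl (dot A) u as"
    by (simp only: eval_mult eval_foldl_mult eval_u eval_trm.simps(2) eval_xs)
qed

lemma is_algebra_fibre:
  assumes A: "A \<in> regularization ar V" and u: "u \<in> carrier A"
  shows "is_algebra ar (fibre A u)"
  unfolding is_algebra_def
proof (intro conjI allI impI)
  have alg: "is_algebra ar A"
    using A by (rule regularization_is_algebra)
  show "carrier (fibre A u) \<noteq> {}"
    using dot_idem[OF A u] u by (auto simp: carrier_fibre)
  fix f as assume as: "length as = ar f" "set as \<subseteq> carrier (fibre A u)"
  then have asA: "set as \<subseteq> carrier A"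
    by (auto simp: carrier_fibre)
  \<comment> \<open>Each argument satisfies u \<cdot> a = u, so the product collapses from the left;
    for a constant it is \<open>u\<close> outright.\<close>
  have "foldl (dot A) u as = u"
    using as(2) by (induction as) (auto simp: carrier_fibre)
  moreover have "interp A f as \<in> carrier A"
    using alg as(1) asA by (auto simp: is_algebra_def)
  ultimately show "interp (fibre A u) f as \<in> carrier (fibre A u)"
    using dot_closed[OF alg] dot_dot_right[OF A] dot_interp[OF A u as(1) asA] u
    by (simp add: carrier_fibre interp_fibre)
qed

text \<open>Every operation of the fibre adds a factor \<open>u\<close>; \<open>interp_dot\<close>
  absorbs those on the arguments into the outermost one.\<close>

lemma eval_fibre:
  assumes A: "A \<in> regularization ar V" and u: "u \<in> carrier A"
    and \<rho>: "range \<rho> \<subseteq> carrier (fibre A u)" and t: "wf_trm ar t"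
  shows "eval_trm (fibre A u) \<rho> t = dot A (eval_trm A \<rho> t) u"
  using t
proof (induction t)
  case (Var v)
  have "\<rho> v \<in> carrier (fibre A u)" using \<rho> by auto
  then show ?case by (simp add: carrier_fibre)
next
  case (Fun f ts)
  have "range \<rho> \<subseteq> carrier A"
    using \<rho> by (auto simp: carrier_fibre)
  then have closed: "set (map (eval_trm A \<rho>) ts) \<subseteq> carrier A"
    using Fun.prems eval_trm_closed[OF regularization_is_algebra[OF A]] by auto
  have "map (eval_trm (fibre A u) \<rho>) ts = map (\<lambda>a. dot A a u) (map (eval_trm A \<rho>) ts)"
    using Fun by auto
  then have "eval_trm (fibre A u) \<rho> (Fun f ts) =
      dot A (interp A f (map (\<lambda>a. dot A a u) (map (eval_trm A \<rho>) ts))) u"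
    by (simp only: eval_trm.simps interp_fibre)
  also have "\<dots> = dot A (interp A f (map (eval_trm A \<rho>) ts)) u"
    by (rule interp_dot[OF A u _ closed]) (use Fun.prems in simp)
  finally show ?case by simp
qed

lemma satisfies_fibre:
  assumes A: "A \<in> regularization ar V" and u: "u \<in> carrier A"
    and e: "e \<in> identities ar" "satisfies A e"
  shows "satisfies (fibre A u) e"
  unfolding satisfies_def
proof (intro allI impI)
  fix \<rho> :: "nat \<Rightarrow> 'u" assume \<rho>: "range \<rho> \<subseteq> carrier (fibre A u)"
  then have "range \<rho> \<subseteq> carrier A"
    by (auto simp: carrier_fibre)
  then have "eval_trm A \<rho> (fst e) = eval_trm A \<rho> (snd e)"
    using e(2) by (auto simp: satisfies_def)
  then show "eval_trm (fibre A u) \<rho> (fst e) = eval_trm (fibre A u) \<rho> (snd e)"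
    using eval_fibre[OF A u \<rho>] e(1) by (auto simp: identities_def)
qed

lemma fibre_mem_subvariety:
  assumes W: "variety ar W" "W \<subseteq> regularization ar V" and A: "A \<in> W" and u: "u \<in> carrier A"
  shows "fibre A u \<in> W"
proof (rule mem_varietyI[OF W(1)])
  have A': "A \<in> regularization ar V"
    using A W(2) by blast
  show "is_algebra ar (fibre A u)"
    using A' u by (rule is_algebra_fibre)
  show "satisfies (fibre A u) e" if "e \<in> identities ar" "holds_in W e" for e
    using satisfies_fibre[OF A' u that(1)] that(2) A by (simp add: holds_in_def)
qed

text \<open>In the fibre \<open>p\<close> takes the value (a \<cdot> b) \<cdot> u = (a \<cdot> (u
  \<cdot> b)) \<cdot> u = (a \<cdot> u) \<cdot> u = a, so the irregular identity p \<approx> x holds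
  there.\<close>

lemma fibre_mem_V:
  assumes A: "A \<in> regularization ar V" and u: "u \<in> carrier A"
  shows "fibre A u \<in> V"
proof (rule mem_V_if_irregular[OF _ p_identity])
  show "fibre A u \<in> regularization ar V"
    by (rule fibre_mem_subvariety[OF variety_regularization subset_refl A u])
  show "satisfies (fibre A u) (p, Var x)"
    unfolding satisfies_def
  proof (intro allI impI)
    fix \<rho> :: "nat \<Rightarrow> 'u" assume \<rho>: "range \<rho> \<subseteq> carrier (fibre A u)"
    have "\<rho> x \<in> carrier (fibre A u)" "\<rho> y \<in> carrier (fibre A u)"
      using \<rho> by auto
    then have "dot A (dot A (\<rho> x) (\<rho> y)) u = \<rho> x"
      using dot_dot_absorb[OF A _ _ u, of "\<rho> x" "\<rho> y"] by (simp add: carrier_fibre)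
    then show "eval_trm (fibre A u) \<rho> (fst (p, Var x)) = eval_trm (fibre A u) \<rho> (snd (p, Var x))"
      using eval_fibre[OF A u \<rho> wf_p] by (simp add: eval_p)
  qed
qed

text \<open>An assignment into \<open>A\<close> is pushed into the fibre of the value
  \<open>u\<close> of \<open>s\<close> by multiplying with \<open>u\<close>; regularity ensures that
  neither side of the identity changes its value.\<close>

lemma satisfies_if_fibres:
  assumes A: "A \<in> regularization ar V" and e: "e \<in> identities ar" "regular e"
    and fibres: "\<And>u. u \<in> carrier A \<Longrightarrow> satisfies (fibre A u) e"
  shows "satisfies A e"
proof -
  obtain s t where st: "e = (s, t)" by fastforce
  have wf: "wf_trm ar s" "wf_trm ar t" and vars: "vars_trm t = vars_trm s"
    using e by (auto simp: st identities_def regular_def)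
  have alg: "is_algebra ar A"
    using A by (rule regularization_is_algebra)
  have "eval_trm A \<rho> s = eval_trm A \<rho> t" if \<rho>: "range \<rho> \<subseteq> carrier A" for \<rho>
  proof -
    define u where "u = eval_trm A \<rho> s"
    \<comment> \<open>Each \<open>\<sigma> v\<close> has exactly the variables of \<open>s\<close>,
      hence mutual absorption with \<open>s\<close>. Variables outside \<open>s\<close> get
      \<open>s\<close> by default, so that the whole range of \<open>\<rho>'\<close> lies in the
      fibre.\<close>
    define \<sigma> where "\<sigma> = (\<lambda>v. if v \<in> vars_trm s then mult (Var v) s else s)"
    define \<rho>' where "\<rho>' = (\<lambda>v. eval_trm A \<rho> (\<sigma> v))"
    have u: "u \<in> carrier A"
      unfolding u_def using alg \<rho> wf(1) by (rule eval_trm_closed)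
    have wf_\<sigma>: "wf_trm ar (\<sigma> v)" for v
      using wf by (simp add: \<sigma>_def)
    have vars_\<sigma>: "vars_trm (\<sigma> v) = vars_trm s" for v
      by (auto simp: \<sigma>_def)
    have \<rho>': "range \<rho>' \<subseteq> carrier (fibre A u)"
    proof -
      have "\<rho>' v \<in> carrier A" for v
        unfolding \<rho>'_def using alg \<rho> wf_\<sigma> by (rule eval_trm_closed)
      moreover have "dot A (\<rho>' v) u = \<rho>' v" "dot A u (\<rho>' v) = u" for v
        unfolding \<rho>'_def u_def using wf wf_\<sigma> vars_\<sigma> by (auto intro!: eval_mult_left[OF A \<rho>])
      ultimately show ?thesis
        by (auto simp: carrier_fibre)
    qed
    \<comment> \<open>Substituting \<open>\<sigma>\<close> and multiplying by \<open>s\<close>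
      leaves \<open>r\<close> unchanged in \<open>V\<close>, and the identity is regular because
      \<open>r\<close> has the variables of \<open>s\<close>.\<close>
    have eval: "eval_trm (fibre A u) \<rho>' r = eval_trm A \<rho> r"
      if r: "wf_trm ar r" "vars_trm r = vars_trm s" for r :: "('f, nat) trm"
    proof -
      have wf': "wf_trm ar (subst_trm \<sigma> r)"
        using r wf_\<sigma> by (auto intro: wf_subst_trm)
      have "eval_trm A \<rho> (mult (subst_trm \<sigma> r) s) = eval_trm A \<rho> r"
      proof (rule regularization_eval_eq[OF A _ _ _ \<rho>])
        fix B and \<tau> :: "nat \<Rightarrow> 'u" assume B: "B \<in> V" "range \<tau> \<subseteq> carrier B"
        have "eval_trm B \<tau> (mult (subst_trm \<sigma> r) s) = eval_trm B \<tau> (subst_trm \<sigma> r)"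
          using B wf' wf(1) by (rule eval_mult_V)
        also have "\<dots> = eval_trm B \<tau> r"
          unfolding eval_subst_trm
          by (rule eval_trm_cong) (use r wf in \<open>simp add: \<sigma>_def eval_mult_V[OF B]\<close>)
        finally show "eval_trm B \<tau> (mult (subst_trm \<sigma> r) s) = eval_trm B \<tau> r" .
      next
        show "vars_trm (mult (subst_trm \<sigma> r) s) = vars_trm r"
          using r vars_\<sigma> by (auto simp: vars_subst_trm)
      qed (use wf' wf r in auto)
      then show ?thesis
        unfolding eval_fibre[OF A u \<rho>' r(1)]
        by (simp add: eval_mult eval_subst_trm \<rho>'_def u_def)
    qed
    have "eval_trm (fibre A u) \<rho>' s = eval_trm (fibre A u) \<rho>' t"
      using fibres[OF u] \<rho>' unfolding st by (rule satisfiesD)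
    then show ?thesis
      by (simp add: eval wf vars)
  qed
  then show ?thesis
    by (simp add: st satisfies_def)
qed

section \<open>Subvarieties of the regularization\<close>

text \<open>Fibres of a member \<open>A\<close> of \<open>W\<close> lie in W \<inter> V, so each
  regular identity of the latter lifts to \<open>A\<close>. Conversely, the identities of
  \<open>W\<close> are all regular and hold in W \<inter> V.\<close>

lemma regular_subvariety_eq:
  assumes W: "variety ar W" "W \<subseteq> regularization ar V"
    and regular: "\<And>e. e \<in> identities ar \<Longrightarrow> holds_in W e \<Longrightarrow> regular e"
  shows "W = regularization ar (W \<inter> V)"
proof
  show "W \<subseteq> regularization ar (W \<inter> V)"
  proof
    fix A assume A: "A \<in> W"
    then have A': "A \<in> regularization ar V"
      using W(2) by blast
    have "fibre A u \<in> W \<inter> V" if "u \<in> carrier A" for u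
      using fibre_mem_subvariety[OF W A that] fibre_mem_V[OF A' that] by blast
    then have "satisfies A e" if "e \<in> identities ar" "regular e" "holds_in (W \<inter> V) e" for e
      using satisfies_if_fibres[OF A' that(1,2)] that(3) by (simp add: holds_in_def)
    then show "A \<in> regularization ar (W \<inter> V)"
      using regularization_is_algebra[OF A'] by (simp add: regularization_def models_def)
  qed
  show "regularization ar (W \<inter> V) \<subseteq> W"
  proof
    fix A assume A: "A \<in> regularization ar (W \<inter> V)"
    show "A \<in> W"
    proof (rule mem_varietyI[OF W(1) regularization_is_algebra[OF A]])
      fix e assume e: "e \<in> identities ar" "holds_in W e"
      then have "regular e" "holds_in (W \<inter> V) e"
        using regular by (auto simp: holds_in_def)
      with A e(1) show "satisfies A e"
        unfolding regularization_def models_def by blast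
    qed
  qed
qed

text \<open>The cases are decided by whether \<open>W\<close> satisfies an irregular
  identity.\<close>

lemma subvariety_cases:
  assumes "variety ar W" "W \<subseteq> regularization ar V"
  obtains "W \<subseteq> V" | "SL ar \<subseteq> W" "W = regularization ar (W \<inter> V)"
proof (cases "\<forall>e \<in> identities ar. holds_in W e \<longrightarrow> regular e")
  case True
  then show ?thesis
    using that(2) SL_subset_if_regular[OF assms(1)] regular_subvariety_eq[OF assms] by blast
next
  case False
  then show ?thesis
    using that(1) subset_V_if_irregular[OF assms(2)] by blast
qed

section \<open>The position of \<open>SL\<close>, and the splitting pairs\<close>

lemma SL_subset_regularization: "variety ar W \<Longrightarrow> SL ar \<subseteq> regularization ar W"
  unfolding SL_def by (intro regularization_mono trivial_variety_subset)

lemma SL_Int: "SL ar \<inter> V = trivial_variety ar"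
  unfolding SL_def
  by (intro regularization_Int variety_trivial_variety trivial_variety_subset variety)

lemma SL_not_subset:
  fixes a b :: 'u
  assumes "a \<noteq> b"
  shows "\<not> SL ar \<subseteq> V"
proof
  assume "SL ar \<subseteq> V"
  then have "holds_in (SL ar :: ('f, 'u) algebra set) (p, Var x)"
    using holds_p by (auto simp: holds_in_def)
  then show False
    using SL_refutes_irregular[OF assms p_identity(1)] p_identity(2) by blast
qed

lemma splitting_pair_SL:
  fixes a b :: 'u
  assumes "a \<noteq> b"
  shows "splitting_pair (subvariety_lattice ar (regularization ar V)) (SL ar) V"
proof -
  have "SL ar \<subseteq> c \<or> c \<subseteq> V" if "variety ar c" "c \<subseteq> regularization ar V" for c
    using that by (cases rule: subvariety_cases) auto
  moreover have "variety ar (SL ar)"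
    by (simp add: SL_def variety_regularization)
  ultimately show ?thesis
    using SL_not_subset[OF assms] SL_subset_regularization[OF variety] variety
      subset_regularization[OF variety]
    unfolding splitting_pair_def subvariety_lattice_def by auto
qed

text \<open>A candidate \<open>c\<close> is tested through c \<inter> V, and R(W) \<inter> V = W
  keeps \<open>V1\<close> out of R(W).\<close>

lemma splitting_pair_regularization:
  assumes split: "splitting_pair (subvariety_lattice ar V) V1 W"
  shows "splitting_pair (subvariety_lattice ar (regularization ar V)) V1 (regularization ar W)"
proof -
  have V1: "variety ar V1" "V1 \<subseteq> V" and W: "variety ar W" "W \<subseteq> V" and not_le: "\<not> V1 \<subseteq> W"
    and le: "\<And>c. variety ar c \<Longrightarrow> c \<subseteq> V \<Longrightarrow> V1 \<subseteq> c \<or> c \<subseteq> W"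
    using split by (auto simp: splitting_pair_def subvariety_lattice_def)
  have "\<not> V1 \<subseteq> regularization ar W"
    using regularization_Int[OF W] V1 not_le by blast
  moreover have "V1 \<subseteq> c \<or> c \<subseteq> regularization ar W"
    if c: "variety ar c" "c \<subseteq> regularization ar V" for c
  proof (cases "V1 \<subseteq> c \<inter> V")
    case False
    then have *: "c \<inter> V \<subseteq> W"
      using le[OF variety_Int[OF c(1) variety]] by blast
    from c show ?thesis
    proof (cases rule: subvariety_cases)
      case 1
      then show ?thesis
        using * subset_regularization[OF W(1)] by blast
    next
      \<comment> \<open>Here c = R(c \<inter> V) \<subseteq> R(W).\<close>
      case 2
      then show ?thesis
        using regularization_mono[OF *, of ar] by simp
    qed
  qed blast
  ultimately show ?thesis
    using V1 W subset_regularization[OF variety] regularization_mono[OF W(2)]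
    by (auto simp: splitting_pair_def subvariety_lattice_def variety_regularization)
qed

text \<open>The position of \<open>V2\<close> decides. If V2 \<subseteq> V, testing the splitting
  property on \<open>V\<close> and \<open>SL\<close> forces the exceptional pair; if V2 = R(V2
  \<inter> V), then V2 \<inter> V is the required \<open>W\<close>.\<close>

lemma splitting_pair_cases:
  fixes a b :: 'u
  assumes "a \<noteq> b"
    and split: "splitting_pair (subvariety_lattice ar (regularization ar V)) V1 V2"
  shows "(V1, V2) = (SL ar, V) \<or>
    (\<exists>W \<in> carrier (subvariety_lattice ar V).
       V2 = regularization ar W \<and> splitting_pair (subvariety_lattice ar V) V1 W)"
proof -
  have V1: "variety ar V1" "V1 \<subseteq> regularization ar V"
    and V2: "variety ar V2" "V2 \<subseteq> regularization ar V" and not_le: "\<not> V1 \<subseteq> V2"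
    and le: "\<And>c. variety ar c \<Longrightarrow> c \<subseteq> regularization ar V \<Longrightarrow> V1 \<subseteq> c \<or> c \<subseteq> V2"
    using split by (auto simp: splitting_pair_def subvariety_lattice_def)
  have le_V: "V1 \<subseteq> V \<or> V \<subseteq> V2"
    by (rule le[OF variety subset_regularization[OF variety]])
  from V2 show ?thesis
  proof (cases rule: subvariety_cases)
    case 1
    have "V1 \<subseteq> SL ar \<or> SL ar \<subseteq> V2"
      using SL_subset_regularization[OF variety]
      by (intro le) (auto simp: SL_def variety_regularization)
    then have V1_SL: "V1 \<subseteq> SL ar"
      using 1 SL_not_subset[OF assms(1)] by blast
    \<comment> \<open>Otherwise V1 \<subseteq> SL \<inter> V, the trivial variety, which lies in
      \<open>V2\<close>.\<close>
    have "\<not> V1 \<subseteq> V"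
      using V1_SL SL_Int trivial_variety_subset[OF V2(1)] not_le by blast
    with le_V 1 have "V2 = V" by blast
    \<comment> \<open>As \<open>V1\<close> is not below \<open>V\<close>, the dichotomy puts
      \<open>SL\<close> below it.\<close>
    moreover from V1 have "V1 = SL ar"
      by (cases rule: subvariety_cases) (use \<open>\<not> V1 \<subseteq> V\<close> V1_SL in auto)
    ultimately show ?thesis by simp
  next
    case 2
    \<comment> \<open>V \<subseteq> V2 would make V2 = R(V), the top of the lattice, against
      \<open>not_le\<close>.\<close>
    have "\<not> V \<subseteq> V2"
    proof
      assume "V \<subseteq> V2"
      then have "V2 \<inter> V = V" by blast
      with 2(2) V1(2) not_le show False by simp
    qed
    with le_V have "V1 \<subseteq> V" by blast
    moreover have "V1 \<subseteq> c \<or> c \<subseteq> V2 \<inter> V" if "variety ar c" "c \<subseteq> V" for c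
      using le[OF that(1)] that(2) subset_regularization[OF variety] by blast
    ultimately have "splitting_pair (subvariety_lattice ar V) V1 (V2 \<inter> V)"
      using V1 not_le variety_Int[OF V2(1) variety]
      by (auto simp: splitting_pair_def subvariety_lattice_def)
    moreover have "V2 \<inter> V \<in> carrier (subvariety_lattice ar V)"
      using variety_Int[OF V2(1) variety] by (simp add: subvariety_lattice_def)
    ultimately show ?thesis
      using 2(2) by blast
  qed
qed

end

theorem theorem8:
  fixes ar :: "'f \<Rightarrow> nat"
    and V V1 V2 :: "('f, 'u) algebra set"
  assumes large_universe: "\<exists>h :: ('f, nat) trm \<Rightarrow> 'u. inj h"
    and "plural ar"
    and "variety ar V"
    and "strongly_irregular ar V"
    and "V1 \<in> carrier (subvariety_lattice ar (regularization ar V))"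
    and "V2 \<in> carrier (subvariety_lattice ar (regularization ar V))"
  shows "splitting_pair (subvariety_lattice ar (regularization ar V)) V1 V2 \<longleftrightarrow>
      (V1, V2) = (SL ar, V) \<or>
      (\<exists>W \<in> carrier (subvariety_lattice ar V).
         V2 = regularization ar W \<and> splitting_pair (subvariety_lattice ar V) V1 W)"
proof -
  obtain h :: "('f, nat) trm \<Rightarrow> 'u" where "inj h"
    using large_universe by blast
  \<comment> \<open>Two distinct points of \<open>'u\<close>, for the two-element semilattice that
    refutes irregular identities.\<close>
  then have ab: "h (Var 0) \<noteq> h (Var 1)"
    by (simp add: inj_eq)
  obtain p x y where "strongly_irregular_variety ar V p x y"
    using assms(3,4) unfolding strongly_irregular_def strongly_irregular_variety_def by blast
  then interpret strongly_irregular_variety ar V p x y .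
  show ?thesis
    using splitting_pair_SL[OF ab] splitting_pair_regularization splitting_pair_cases[OF ab]
    by blast
qed

end
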